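(* Let $L$ be a denumerable (countably infinite) set (a language). Then the set $\mathcal{C}_f(L)$ of all finite consequence operators on $\mathcal{P}(L)$ has the power of the continuum: $|\mathcal{C}_f(L)|=|\mathbb{R}|$.
   Context: $\mathcal{P}(L)$ is the power set of $L$ and $\mathcal{F}(X)$ is the set of all finite subsets of $X$. A finite consequence operator on $\mathcal{P}(L)$ is a map $C\colon\mathcal{P}(L)\to\mathcal{P}(L)$ such that for all $X,Y\subset L$: (1) $X\subset C(X)=C(C(X))$; (2) if $X\subset Y$, then $C(X)\subset C(Y)$; (3) $C(X)=\bigcup\{C(F)\mid F\in\mathcal{F}(X)\}$. The Axiom of Choice may be assumed. *)

theory Defs
  imports Complex_Main "HOL-Library.FuncSet" "HOL-Library.Countable_Set" "HOL-Library.Equipollence"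
begin

text \<open>
  A map \<open>\<P>(L) \<rightarrow> \<P>(L)\<close> is an element of \<open>Pow L \<rightarrow>\<^sub>E Pow L\<close>: it is \<open>undefined\<close> outside \<open>Pow L\<close>,
  so that two HOL functions count as different operators only if they differ on \<open>Pow L\<close>.
\<close>

definition finite_consequence_operator :: "'a set \<Rightarrow> ('a set \<Rightarrow> 'a set) \<Rightarrow> bool" where
  "finite_consequence_operator L C \<longleftrightarrow>
     C \<in> Pow L \<rightarrow>\<^sub>E Pow L \<and>
     (\<forall>X. X \<subseteq> L \<longrightarrow> X \<subseteq> C X \<and> C X = C (C X)) \<and>
     (\<forall>X Y. X \<subseteq> L \<longrightarrow> Y \<subseteq> L \<longrightarrow> X \<subseteq> Y \<longrightarrow> C X \<subseteq> C Y) \<and>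
     (\<forall>X. X \<subseteq> L \<longrightarrow> C X = \<Union> {C F |F. F \<in> Fpow X})"

definition finite_consequence_operators :: "'a set \<Rightarrow> ('a set \<Rightarrow> 'a set) set" where
  "finite_consequence_operators L = {C. finite_consequence_operator L C}"

end

(* A finite operator is determined by its values on finite sets, hence by a subset of the
   countable set Fpow L \<times> L. Conversely, the operators X \<mapsto> X \<union> A for A \<subseteq> L are finite
   consequence operators, and A is recovered as the value at the empty set. *)

theory Submission
  imports Defs "HOL-Analysis.Abstract_Topology_2"
begin

lemma Pow_lepoll_mono:
  assumes "A \<lesssim> B"
  shows "Pow A \<lesssim> Pow B"
proof -
  obtain f where "inj_on f A" "f ` A \<subseteq> B"
    using assms unfolding lepoll_def by blast
  then have "inj_on (image f) (Pow A)" "image f ` Pow A \<subseteq> Pow B"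
    by (auto intro: inj_on_image_Pow)
  then show ?thesis
    unfolding lepoll_def by blast
qed

text \<open>An injection of \<open>A\<close> into the naturals carries \<open>Pow A\<close> into the
  sets of naturals, and these have the power of the continuum.\<close>

lemma countable_Pow_lepoll_reals:
  assumes "countable A"
  shows "Pow A \<lesssim> (UNIV :: real set)"
proof -
  have "A \<lesssim> (UNIV :: nat set)"
    using assms unfolding countable_def lepoll_def by blast
  then have "Pow A \<lesssim> (UNIV :: nat set set)"
    using Pow_lepoll_mono by (metis Pow_UNIV)
  then show ?thesis
    using nat_sets_eqpoll_reals by (rule lepoll_trans2)
qed

text \<open>An infinite set contains a copy of the naturals, so its power set contains a copy of
  \<open>Pow \<nat>\<close>.\<close>

lemma reals_lepoll_infinite_Pow:
  assumes "infinite A"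
  shows "(UNIV :: real set) \<lesssim> Pow A"
proof -
  have "(UNIV :: nat set) \<lesssim> A"
    using assms infinite_le_lepoll by blast
  then have "(UNIV :: nat set set) \<lesssim> Pow A"
    using Pow_lepoll_mono by (metis Pow_UNIV)
  then show ?thesis
    by (rule lepoll_trans1[OF eqpoll_sym[OF nat_sets_eqpoll_reals]])
qed

text \<open>Condition (3) expresses each value on \<open>Pow L\<close> through the values at finite
  sets; outside \<open>Pow L\<close> both functions are \<open>undefined\<close>.\<close>

lemma finite_consequence_operator_eqI:
  assumes C: "finite_consequence_operator L C" and D: "finite_consequence_operator L D"
    and eq: "\<And>F. F \<in> Fpow L \<Longrightarrow> C F = D F"
  shows "C = D"
proof (rule PiE_ext)
  show "C \<in> Pow L \<rightarrow>\<^sub>E Pow L" "D \<in> Pow L \<rightarrow>\<^sub>E Pow L"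
    using C D unfolding finite_consequence_operator_def by auto
next
  fix X assume "X \<in> Pow L"
  then have X: "X \<subseteq> L" by simp
  have "C X = \<Union> {C F |F. F \<in> Fpow X}"
    using C X by (simp add: finite_consequence_operator_def)
  \<comment> \<open>A finite subset of \<open>X\<close> is a finite subset of \<open>L\<close>, so
    \<open>eq\<close> applies to it.\<close>
  also have "{C F |F. F \<in> Fpow X} = {D F |F. F \<in> Fpow X}"
    unfolding Setcompr_eq_image using eq Fpow_mono[OF X] by (intro image_cong) auto
  also have "\<Union> \<dots> = D X"
    using D X by (simp add: finite_consequence_operator_def)
  finally show "C X = D X" .
qed

lemma finite_consequence_operators_lepoll:
  "finite_consequence_operators L \<lesssim> Pow (Fpow L \<times> L)"
proof -
  \<comment> \<open>The values at finite sets are packed into one relation: \<open>(F, x)\<close>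
    belongs to it iff \<open>F\<close> is a finite subset of \<open>L\<close> and
    \<open>x \<in> C F\<close>.\<close>
  let ?graph = "\<lambda>C. SIGMA F:Fpow L. C F"
  have "inj_on ?graph (finite_consequence_operators L)"
  proof (rule inj_onI)
    fix C D
    assume CD: "C \<in> finite_consequence_operators L" "D \<in> finite_consequence_operators L"
      and eq: "?graph C = ?graph D"
    have "C F = D F" if "F \<in> Fpow L" for F
    proof -
      \<comment> \<open>For \<open>F\<close> in \<open>Fpow L\<close>, the section of the relation
        at \<open>F\<close> is exactly \<open>C F\<close>.\<close>
      have "?graph C `` {F} = ?graph D `` {F}"
        using eq by simp
      then show ?thesis
        using that by auto
    qed
    then show "C = D"
      using CD finite_consequence_operator_eqI
      unfolding finite_consequence_operators_def by blast
  qed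
  moreover have "?graph C \<subseteq> Fpow L \<times> L" if "C \<in> finite_consequence_operators L" for C
  proof -
    have "C \<in> Pow L \<rightarrow>\<^sub>E Pow L"
      using that by (simp add: finite_consequence_operators_def finite_consequence_operator_def)
    then have "C F \<in> Pow L" if "F \<in> Fpow L" for F
      using that by (auto simp: Fpow_def)
    then show ?thesis
      by blast
  qed
  ultimately show ?thesis
    unfolding lepoll_def by blast
qed

text \<open>Adding \<open>A\<close> a second time changes nothing, which gives idempotence;
  \<open>A \<subseteq> L\<close> keeps the values inside \<open>Pow L\<close>.\<close>

lemma finite_consequence_operator_union:
  assumes "A \<subseteq> L"
  shows "finite_consequence_operator L (restrict (\<lambda>X. X \<union> A) (Pow L))"
proof -
  let ?C = "restrict (\<lambda>X. X \<union> A) (Pow L)"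
  have finitary: "?C X = \<Union> {?C F |F. F \<in> Fpow X}" if X: "X \<subseteq> L" for X
  proof -
    have "{?C F |F. F \<in> Fpow X} = (\<lambda>F. F \<union> A) ` Fpow X"
      unfolding Setcompr_eq_image using X by (intro image_cong) (auto simp: Fpow_def)
    moreover have "(\<Union>F\<in>Fpow X. F \<union> A) = X \<union> A"
    proof (rule equalityI[rotated])
      show "X \<union> A \<subseteq> (\<Union>F\<in>Fpow X. F \<union> A)"
      proof
        fix x assume x: "x \<in> X \<union> A"
        \<comment> \<open>This witness avoids a case split: it is \<open>{x}\<close> if
          \<open>x \<in> X\<close>, and otherwise it is empty and \<open>x\<close> comes from
          \<open>A\<close>.\<close>
        have "X \<inter> {x} \<in> Fpow X"
          by (simp add: Fpow_def)
        moreover have "x \<in> (X \<inter> {x}) \<union> A"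
          using x by blast
        ultimately show "x \<in> (\<Union>F\<in>Fpow X. F \<union> A)"
          by (rule UN_I)
      qed
    qed (auto simp: Fpow_def)
    ultimately show ?thesis
      using X by (metis Pow_iff restrict_apply')
  qed
  show ?thesis
    unfolding finite_consequence_operator_def
  proof (intro conjI allI impI)
    show "?C \<in> Pow L \<rightarrow>\<^sub>E Pow L"
      using assms by auto
  next
    fix X assume "X \<subseteq> L"
    then show "X \<subseteq> ?C X" "?C X = ?C (?C X)"
      using assms by auto
  next
    fix X Y assume "X \<subseteq> L" "Y \<subseteq> L" "X \<subseteq> Y"
    then show "?C X \<subseteq> ?C Y"
      by auto
  qed (rule finitary)
qed

lemma Pow_lepoll_finite_consequence_operators:
  "Pow L \<lesssim> finite_consequence_operators L"
proof -
  let ?op = "\<lambda>A. restrict (\<lambda>X. X \<union> A) (Pow L)"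
  have "inj_on ?op (Pow L)"
  proof (rule inj_onI)
    fix A B
    assume "?op A = ?op B"
    then have "?op A {} = ?op B {}"
      by (rule fun_cong)
    then show "A = B"
      by simp
  qed
  moreover have "?op ` Pow L \<subseteq> finite_consequence_operators L"
    using finite_consequence_operator_union unfolding finite_consequence_operators_def by blast
  ultimately show ?thesis
    unfolding lepoll_def by blast
qed

theorem mainTheorem6:
  fixes L :: "'a set"
  assumes "countable L" and "infinite L"
  shows "finite_consequence_operators L \<approx> (UNIV :: real set)"
proof (rule lepoll_antisym)
  \<comment> \<open>Upper bound: a countable set has only countably many finite subsets, so the
    relations encoding operators live on a countable set.\<close>
  have "countable (Fpow L)"
    using countable_Collect_finite_subset[OF assms(1)] by (simp add: Fpow_def conj_commute)
  then have "Pow (Fpow L \<times> L) \<lesssim> (UNIV :: real set)"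
    using assms(1) by (intro countable_Pow_lepoll_reals) auto
  then show "finite_consequence_operators L \<lesssim> (UNIV :: real set)"
    by (rule lepoll_trans[OF finite_consequence_operators_lepoll])
next
  \<comment> \<open>Lower bound: the reals embed into \<open>Pow L\<close> because \<open>L\<close>
    is infinite, and each \<open>A \<subseteq> L\<close> gives its own operator.\<close>
  show "(UNIV :: real set) \<lesssim> finite_consequence_operators L"
    using reals_lepoll_infinite_Pow[OF assms(2)] Pow_lepoll_finite_consequence_operators
    by (rule lepoll_trans)
qed

end
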